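(* Let $d,n\in\mathbb{N}$ and let $g,\tilde g\in\mathbb{R}[\mathbf{x}]$ be polynomials of degree $d$ such that $\mathbf{G}=\{\mathbf{x}\in\mathbb{R}^n:g(\mathbf{x})<1\}$ and $\tilde{\mathbf{G}}=\{\mathbf{x}:\tilde g(\mathbf{x})<1\}$ are bounded, and $g(0)\neq1$, $\tilde g(0)\ne1$. (i) If $\int_{\mathbf{G}}\mathbf{x}^\alpha d\mathbf{x}=\int_{\tilde{\mathbf{G}}}\mathbf{x}^\alpha d\mathbf{x}$ for all $\alpha\in\mathbb{N}^n$ with $|\alpha|\le 3d$, then this equality holds for all $\alpha\in\mathbb{N}^n$; that is, the full moment sequence of Lebesgue measure restricted to $\mathbf{G}$ is determined by its moments of order at most $3d$. (ii) Let moreover $p\in\mathbb{R}[\mathbf{x}]$ have degree at most $t$. If $\int_{\mathbf{G}}\mathbf{x}^\alpha e^{p(\mathbf{x})}d\mathbf{x}=\int_{\tilde{\mathbf{G}}}\mathbf{x}^\alpha e^{p(\mathbf{x})}d\mathbf{x}$ for all $|\alpha|\le 3d+t$, then this equality holds for all $\alpha\in\mathbb{N}^n$.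
   Context: $\mathbf{x}^\alpha=x_1^{\alpha_1}\cdots x_n^{\alpha_n}$, $|\alpha|=\sum_i\alpha_i$; integrals with respect to Lebesgue measure. *)

theory Defs
  imports "HOL-Analysis.Analysis"
begin

text \<open>Multivariate real polynomials in n variables, n = CARD('n), represented by their
  coefficient functions on exponent vectors alpha :: 'n => nat (finite support).\<close>

definition monom :: "real ^ 'n \<Rightarrow> ('n::finite \<Rightarrow> nat) \<Rightarrow> real" where
  "monom x \<alpha> = (\<Prod>i\<in>UNIV. (x $ i) ^ (\<alpha> i))"

definition mdeg :: "('n::finite \<Rightarrow> nat) \<Rightarrow> nat" where
  "mdeg \<alpha> = (\<Sum>i\<in>UNIV. \<alpha> i)"

definition is_mpoly :: "(('n::finite \<Rightarrow> nat) \<Rightarrow> real) \<Rightarrow> bool" where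
  "is_mpoly c \<longleftrightarrow> finite {\<alpha>. c \<alpha> \<noteq> 0}"

definition meval :: "(('n::finite \<Rightarrow> nat) \<Rightarrow> real) \<Rightarrow> real ^ 'n \<Rightarrow> real" where
  "meval c x = (\<Sum>\<alpha>\<in>{\<alpha>. c \<alpha> \<noteq> 0}. c \<alpha> * monom x \<alpha>)"

definition mpoly_degree_eq :: "(('n::finite \<Rightarrow> nat) \<Rightarrow> real) \<Rightarrow> nat \<Rightarrow> bool" where
  "mpoly_degree_eq c d \<longleftrightarrow> is_mpoly c \<and> (\<forall>\<alpha>. c \<alpha> \<noteq> 0 \<longrightarrow> mdeg \<alpha> \<le> d)
      \<and> (\<exists>\<alpha>. c \<alpha> \<noteq> 0 \<and> mdeg \<alpha> = d)"

definition mpoly_degree_le :: "(('n::finite \<Rightarrow> nat) \<Rightarrow> real) \<Rightarrow> nat \<Rightarrow> bool" where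
  "mpoly_degree_le c t \<longleftrightarrow> is_mpoly c \<and> (\<forall>\<alpha>. c \<alpha> \<noteq> 0 \<longrightarrow> mdeg \<alpha> \<le> t)"

end

theory Submission
  imports Defs
begin

text \<open>
  On \<open>G - G'\<close> one has \<open>g < 1 \<le> g'\<close>, and on \<open>G' - G\<close> one has \<open>g' < 1 \<le> g\<close>. Hence
  \<open>(1\<^sub>G - 1\<^sub>G\<^sub>') (g' - g)\<close> is nonnegative, and positive exactly on the symmetric
  difference. Its integral against any measure is a combination of differences of moments of
  order at most \<open>d\<close>; if these agree, the symmetric difference is a null set, and then all
  moments agree. The exponential weight only changes the measure.
\<close>

lemma set_integrable_continuous_on_closure:
  fixes f :: "'a::euclidean_space \<Rightarrow> 'b::{banach, second_countable_topology}"
  assumes "bounded S" "S \<in> sets borel" "continuous_on (closure S) f"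
  shows "set_integrable lborel S f"
proof (rule set_integrable_subset)
  show "set_integrable lborel (closure S) f"
    unfolding set_integrable_def
    using assms by (intro borel_integrable_compact) auto
qed (use assms closure_subset in auto)

lemma set_integrable_density:
  fixes f :: "'a \<Rightarrow> 'b::{banach, second_countable_topology}" and w :: "'a \<Rightarrow> real"
  assumes "S \<in> sets M" "f \<in> borel_measurable M"
    and "w \<in> borel_measurable M" "AE x in M. 0 \<le> w x"
  shows "set_integrable (density M w) S f \<longleftrightarrow> set_integrable M S (\<lambda>x. w x *\<^sub>R f x)"
  unfolding set_integrable_def
  using assms by (subst integrable_density) (simp_all add: ac_simps)

lemma set_integral_density:
  fixes f :: "'a \<Rightarrow> 'b::{banach, second_countable_topology}" and w :: "'a \<Rightarrow> real"
  assumes "S \<in> sets M" "f \<in> borel_measurable M"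
    and "w \<in> borel_measurable M" "AE x in M. 0 \<le> w x"
  shows "(LINT x:S|density M w. f x) = (LINT x:S|M. w x *\<^sub>R f x)"
  unfolding set_lebesgue_integral_def
  using assms by (subst integral_density) (simp_all add: ac_simps)

lemma AE_mem_iff_if_set_integral_eq:
  fixes h :: "'a \<Rightarrow> real"
  assumes "set_integrable M A h" "set_integrable M B h"
    and "(LINT x:A|M. h x) = (LINT x:B|M. h x)"
    and pos: "\<And>x. x \<in> A - B \<Longrightarrow> 0 < h x" and neg: "\<And>x. x \<in> B - A \<Longrightarrow> h x < 0"
  shows "AE x in M. x \<in> A \<longleftrightarrow> x \<in> B"
proof -
  define F where "F = (\<lambda>x. indicator A x *\<^sub>R h x - indicator B x *\<^sub>R h x)"
  have F_cases: "F x = (if x \<in> A \<longleftrightarrow> x \<in> B then 0 else \<bar>h x\<bar>)" for x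
    using pos[of x] neg[of x] by (auto simp: F_def indicator_def)
  have "integrable M F" "integral\<^sup>L M F = 0"
    using assms(1-3) by (simp_all add: F_def set_integrable_def set_lebesgue_integral_def)
  then have "AE x in M. F x = 0"
    by (subst (asm) integral_nonneg_eq_0_iff_AE) (simp_all add: F_cases)
  moreover have "x \<in> A \<longleftrightarrow> x \<in> B" if "F x = 0" for x
    using that pos[of x] neg[of x] by (auto simp: F_cases split: if_splits)
  ultimately show ?thesis
    by (auto elim: eventually_mono)
qed

lemma continuous_on_monom [continuous_intros]:
  "continuous_on S f \<Longrightarrow> continuous_on S (\<lambda>x. monom (f x) \<alpha>)"
  unfolding monom_def by (intro continuous_intros)

lemma continuous_on_meval [continuous_intros]:
  "continuous_on S f \<Longrightarrow> continuous_on S (\<lambda>x. meval c (f x))"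
  unfolding meval_def by (intro continuous_intros)

lemma borel_measurable_monom [measurable]: "(\<lambda>x. monom x \<alpha>) \<in> borel_measurable borel"
  by (intro borel_measurable_continuous_onI continuous_intros)

lemma borel_measurable_meval [measurable]: "meval c \<in> borel_measurable borel"
  by (intro borel_measurable_continuous_onI continuous_intros)

definition moment :: "(real ^ 'n) measure \<Rightarrow> (real ^ 'n) set \<Rightarrow> ('n::finite \<Rightarrow> nat) \<Rightarrow> real" where
  "moment M S \<alpha> = (LINT x:S|M. monom x \<alpha>)"

definition has_moments :: "(real ^ 'n::finite) measure \<Rightarrow> (real ^ 'n) set \<Rightarrow> bool" where
  "has_moments M S \<longleftrightarrow> (\<forall>\<alpha>. set_integrable M S (\<lambda>x. monom x \<alpha>))"

lemma set_integrable_meval: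
  assumes "has_moments M S"
  shows "set_integrable M S (meval c)"
  using assms unfolding has_moments_def set_integrable_def meval_def scaleR_sum_right
  by (intro Bochner_Integration.integrable_sum) (simp add: mult.left_commute)

lemma set_integral_meval:
  assumes "has_moments M S"
  shows "(LINT x:S|M. meval c x) = (\<Sum>\<alpha> | c \<alpha> \<noteq> 0. c \<alpha> * moment M S \<alpha>)"
proof -
  have "(LINT x:S|M. meval c x)
      = (LINT x|M. (\<Sum>\<alpha> | c \<alpha> \<noteq> 0. c \<alpha> * (indicator S x *\<^sub>R monom x \<alpha>)))"
    unfolding set_lebesgue_integral_def meval_def
    by (simp add: sum_distrib_left mult.left_commute)
  also have "\<dots> = (\<Sum>\<alpha> | c \<alpha> \<noteq> 0. c \<alpha> * moment M S \<alpha>)"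
    using assms unfolding has_moments_def moment_def set_lebesgue_integral_def set_integrable_def
    by (subst Bochner_Integration.integral_sum) auto
  finally show ?thesis .
qed

lemma set_integral_meval_eq_if_moments_eq:
  assumes "mpoly_degree_le c d" "has_moments M S" "has_moments M T"
    and "\<And>\<alpha>. mdeg \<alpha> \<le> d \<Longrightarrow> moment M S \<alpha> = moment M T \<alpha>"
  shows "(LINT x:S|M. meval c x) = (LINT x:T|M. meval c x)"
  using assms by (auto simp: set_integral_meval mpoly_degree_le_def intro!: sum.cong)

abbreviation (input) sublevel :: "(('n::finite \<Rightarrow> nat) \<Rightarrow> real) \<Rightarrow> real \<Rightarrow> (real ^ 'n) set" where
  "sublevel c a \<equiv> {x. meval c x < a}"

lemma AE_sublevel_iff_if_moments_eq:
  assumes deg: "mpoly_degree_le g d" "mpoly_degree_le g' d"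
    and moments: "has_moments M (sublevel g a)" "has_moments M (sublevel g' a)"
    and moments_eq:
      "\<And>\<alpha>. mdeg \<alpha> \<le> d \<Longrightarrow> moment M (sublevel g a) \<alpha> = moment M (sublevel g' a) \<alpha>"
  shows "AE x in M. x \<in> sublevel g a \<longleftrightarrow> x \<in> sublevel g' a"
proof (rule AE_mem_iff_if_set_integral_eq)
  show "set_integrable M (sublevel g a) (\<lambda>x. meval g' x - meval g x)"
    "set_integrable M (sublevel g' a) (\<lambda>x. meval g' x - meval g x)"
    using moments by (simp_all add: set_integrable_meval)
  have "(LINT x:sublevel g a|M. meval c x) = (LINT x:sublevel g' a|M. meval c x)"
    if "c \<in> {g, g'}" for c
    using that deg moments moments_eq by (intro set_integral_meval_eq_if_moments_eq[of c d]) auto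
  then show "(LINT x:sublevel g a|M. meval g' x - meval g x)
      = (LINT x:sublevel g' a|M. meval g' x - meval g x)"
    using moments by (simp add: set_integrable_meval)
qed auto

lemma moment_sublevel_eq_if_moments_eq:
  assumes "mpoly_degree_le g d" "mpoly_degree_le g' d"
    and moments: "has_moments M (sublevel g a)" "has_moments M (sublevel g' a)"
    and "\<And>\<alpha>. mdeg \<alpha> \<le> d \<Longrightarrow> moment M (sublevel g a) \<alpha> = moment M (sublevel g' a) \<alpha>"
  shows "moment M (sublevel g a) \<alpha> = moment M (sublevel g' a) \<alpha>"
proof -
  have "AE x in M. x \<in> sublevel g' a \<longleftrightarrow> x \<in> sublevel g a"
    using assms by (intro AE_sublevel_iff_if_moments_eq) auto
  moreover have "set_borel_measurable M S (\<lambda>x. monom x \<alpha>)" if "has_moments M S" for S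
    using that unfolding has_moments_def set_integrable_def set_borel_measurable_def
    by (intro borel_measurable_integrable) simp
  ultimately show ?thesis
    unfolding moment_def using moments by (intro set_integral_cong_set)
qed

lemma has_moments_density_lborel:
  fixes w :: "real ^ 'n::finite \<Rightarrow> real"
  assumes "bounded S" "S \<in> sets borel"
    and "continuous_on UNIV w" "\<And>x. 0 \<le> w x"
  shows "has_moments (density lborel w) S"
  unfolding has_moments_def
proof
  fix \<alpha> :: "'n \<Rightarrow> nat"
  have "set_integrable lborel S (\<lambda>x. w x *\<^sub>R monom x \<alpha>)"
    using assms
    by (intro set_integrable_continuous_on_closure continuous_intros)
      (auto intro: continuous_on_subset)
  then show "set_integrable (density lborel w) S (\<lambda>x. monom x \<alpha>)"
    using assms by (simp add: set_integrable_density borel_measurable_continuous_onI)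
qed

lemma moment_density_lborel:
  fixes w :: "real ^ 'n::finite \<Rightarrow> real"
  assumes "S \<in> sets borel" "w \<in> borel_measurable borel" "\<And>x. 0 \<le> w x"
  shows "moment (density lborel w) S \<alpha> = (LINT x:S|lborel. monom x \<alpha> * w x)"
  unfolding moment_def using assms by (simp add: set_integral_density mult.commute)

lemma set_integral_monom_sublevel_eq_if_moments_eq:
  fixes w :: "real ^ 'n::finite \<Rightarrow> real"
  assumes deg: "mpoly_degree_le g d" "mpoly_degree_le g' d"
    and bounded: "bounded (sublevel g a)" "bounded (sublevel g' a)"
    and w: "continuous_on UNIV w" "\<And>x. 0 \<le> w x"
    and moments_eq: "\<And>\<alpha>. mdeg \<alpha> \<le> d \<Longrightarrow>
      (LINT x:sublevel g a|lborel. monom x \<alpha> * w x)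
      = (LINT x:sublevel g' a|lborel. monom x \<alpha> * w x)"
  shows "(LINT x:sublevel g a|lborel. monom x \<alpha> * w x)
    = (LINT x:sublevel g' a|lborel. monom x \<alpha> * w x)"
proof -
  have integral_eq_moment:
    "(LINT x:sublevel c a|lborel. monom x \<beta> * w x) = moment (density lborel w) (sublevel c a) \<beta>"
    for c \<beta>
    using w by (simp add: moment_density_lborel borel_measurable_continuous_onI)
  have "has_moments (density lborel w) (sublevel g a)"
    "has_moments (density lborel w) (sublevel g' a)"
    using bounded w by (simp_all add: has_moments_density_lborel)
  then show ?thesis
    using moments_eq unfolding integral_eq_moment
    by (rule moment_sublevel_eq_if_moments_eq[OF deg])
qed

theorem theorem2:
  fixes g g' p :: "('n::finite \<Rightarrow> nat) \<Rightarrow> real" and d t :: nat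
  assumes "mpoly_degree_eq g d" and "mpoly_degree_eq g' d"
    and "bounded {x. meval g x < 1}" and "bounded {x. meval g' x < 1}"
    and "meval g 0 \<noteq> 1" and "meval g' 0 \<noteq> 1"
    and "mpoly_degree_le p t"
  shows "((\<forall>\<alpha>. mdeg \<alpha> \<le> 3 * d \<longrightarrow>
             (LINT x:{x. meval g x < 1}|lborel. monom x \<alpha>) =
             (LINT x:{x. meval g' x < 1}|lborel. monom x \<alpha>))
          \<longrightarrow> (\<forall>\<alpha>. (LINT x:{x. meval g x < 1}|lborel. monom x \<alpha>) =
                    (LINT x:{x. meval g' x < 1}|lborel. monom x \<alpha>)))
       \<and> ((\<forall>\<alpha>. mdeg \<alpha> \<le> 3 * d + t \<longrightarrow>
             (LINT x:{x. meval g x < 1}|lborel. monom x \<alpha> * exp (meval p x)) =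
             (LINT x:{x. meval g' x < 1}|lborel. monom x \<alpha> * exp (meval p x)))
          \<longrightarrow> (\<forall>\<alpha>. (LINT x:{x. meval g x < 1}|lborel. monom x \<alpha> * exp (meval p x)) =
                    (LINT x:{x. meval g' x < 1}|lborel. monom x \<alpha> * exp (meval p x))))"
proof -
  have deg: "mpoly_degree_le g d" "mpoly_degree_le g' d"
    using assms(1,2) by (auto simp: mpoly_degree_eq_def mpoly_degree_le_def)
  have "continuous_on UNIV (\<lambda>x. exp (meval p x))"
    by (intro continuous_intros)
  then show ?thesis
    using set_integral_monom_sublevel_eq_if_moments_eq[OF deg assms(3,4), of "\<lambda>_. 1"]
      set_integral_monom_sublevel_eq_if_moments_eq[OF deg assms(3,4), of "\<lambda>x. exp (meval p x)"]
    by simp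
qed

end
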